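(* Let $\lambda,\mu\in\mathbb{R}$ and let $s\ge 1$ be an integer. For each $k=0,\dots,2s-1$ and for each choice of sign $\pm$ the following recursion formula holds for all $x$: $$A_{\pm}\,p_{2s+1,k+2}(x)=x\cdot p_{2s-1,k}(x)-(k+1)\cdot p_{2s\pm,k+1}(x),$$ where the constant $A_{\pm}$ is given by $$A_{\pm}=(k+2)\,p_{2s-1,k}^{(k+1)}(0)-(k+1)\,p_{2s\pm,k+1}^{(k+2)}(0).$$
   Context: For a vector $\Lambda_n=(\lambda_0,\dots,\lambda_n)\in\mathbb{R}^{n+1}$, $E_{\Lambda_n}$ is the $(n+1)$-dimensional space of all $f\in C^\infty(\mathbb{R},\mathbb{C})$ with $\left(\frac{d}{dx}-\lambda_0\right)\cdots\left(\frac{d}{dx}-\lambda_n\right)f=0$. For $k=0,\dots,n$, $p_{\Lambda_n,k}$ denotes the unique element of $E_{\Lambda_n}$ having a zero of exact order $k$ at $0$, a zero of exact order $n-k$ at $1$, and normalized by $p_{\Lambda_n,k}^{(k)}(0)=1$ (it exists because the $\lambda_j$ are real). A zero of exact order $k$ at $a$ means $f(a)=\dots=f^{(k-1)}(a)=0$ and $f^{(k)}(a)\ne0$. Put $\Lambda_{2s+1}:=(\lambda\ (s+1\text{ times}),\ \mu\ (s+1\text{ times}))$, so that $\Lambda_{2s-1}=(\lambda\ (s\text{ times}),\ \mu\ (s\text{ times}))$, and $\Lambda_{2s+}:=(\lambda\ (s+1\text{ times}),\ \mu\ (s\text{ times}))$, $\Lambda_{2s-}:=(\lambda\ (s\text{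 times}),\ \mu\ (s+1\text{ times}))$ (the latter two have $2s+1$ entries, i.e. $n=2s$). Write $p_{2s+1,k}:=p_{\Lambda_{2s+1},k}$, $p_{2s-1,k}:=p_{\Lambda_{2s-1},k}$, $p_{2s\pm,k}:=p_{\Lambda_{2s\pm},k}$. *)

theory Defs
  imports "HOL-Analysis.Analysis"
begin

text \<open>
  The library constant \<open>deriv\<close> requires equal domain and range types, so derivatives of functions
  from the reals to the complex numbers are expressed by \<open>vector_derivative\<close>. That constant is
  junk where the function is not differentiable, hence \<open>smooth\<close> below asks for differentiability
  of every iterate.
\<close>

definition nth_deriv :: "nat \<Rightarrow> (real \<Rightarrow> complex) \<Rightarrow> real \<Rightarrow> complex" where
  "nth_deriv k f = ((\<lambda>g x. vector_derivative g (at x)) ^^ k) f"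

definition smooth :: "(real \<Rightarrow> complex) \<Rightarrow> bool" where
  "smooth f \<longleftrightarrow> (\<forall>k x. nth_deriv k f differentiable (at x))"

definition diff_op :: "real list \<Rightarrow> (real \<Rightarrow> complex) \<Rightarrow> real \<Rightarrow> complex" where
  "diff_op \<Lambda> f = foldr (\<lambda>l g x. vector_derivative g (at x) - complex_of_real l * g x) \<Lambda> f"

definition exp_poly_space :: "real list \<Rightarrow> (real \<Rightarrow> complex) set" where
  "exp_poly_space \<Lambda> = {f. smooth f \<and> (\<forall>x. diff_op \<Lambda> f x = 0)}"

definition zero_of_exact_order :: "(real \<Rightarrow> complex) \<Rightarrow> nat \<Rightarrow> real \<Rightarrow> bool" where
  "zero_of_exact_order f k a \<longleftrightarrow> (\<forall>j<k. nth_deriv j f a = 0) \<and> nth_deriv k f a \<noteq> 0"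

text \<open>
  A vector with entries \<open>\<lambda>\<^sub>0, \<dots>, \<lambda>\<^sub>n\<close> is a list of length \<open>n + 1\<close>, so \<open>n = length \<Lambda> - 1\<close>.
  The description is meaningful for nonempty \<open>\<Lambda>\<close> and \<open>k \<le> n\<close> only.
\<close>

definition bernstein :: "real list \<Rightarrow> nat \<Rightarrow> real \<Rightarrow> complex" where
  "bernstein \<Lambda> k = (THE p. p \<in> exp_poly_space \<Lambda> \<and>
     zero_of_exact_order p k 0 \<and>
     zero_of_exact_order p (length \<Lambda> - 1 - k) 1 \<and>
     nth_deriv k p 0 = 1)"

definition two_exponents :: "nat \<Rightarrow> nat \<Rightarrow> real \<Rightarrow> real \<Rightarrow> real list" where
  "two_exponents a b lam mu = replicate a lam @ replicate b mu"

text \<open>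
  Below, \<open>Lambda_odd s\<close> has \<open>2 s\<close> entries, i.e. its subscript is \<open>n = 2 s - 1\<close>; hence
  the subscript \<open>2 s + 1\<close> is \<open>Lambda_odd (s + 1)\<close>. The other two have subscript \<open>n = 2 s\<close>.
\<close>

definition Lambda_odd :: "nat \<Rightarrow> real \<Rightarrow> real \<Rightarrow> real list" where
  "Lambda_odd s lam mu = two_exponents s s lam mu"

definition Lambda_plus :: "nat \<Rightarrow> real \<Rightarrow> real \<Rightarrow> real list" where
  "Lambda_plus s lam mu = two_exponents (s + 1) s lam mu"

definition Lambda_minus :: "nat \<Rightarrow> real \<Rightarrow> real \<Rightarrow> real list" where
  "Lambda_minus s lam mu = two_exponents s (s + 1) lam mu"

end

theory Submission
  imports Defs
begin

text \<open>
  The right-hand side minus \<open>A\<close> times the Bernstein function on the left lies in the space of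
  dimension \<open>2 s + 2\<close> and vanishes to order \<open>k + 3\<close> at \<open>0\<close> and to order \<open>2 s - 1 - k\<close> at \<open>1\<close>. Since
  \<open>d/dx - \<lambda>\<close> is differentiation conjugated by \<open>exp (\<lambda> x)\<close>, Rolle's theorem shows that a nonzero
  element of an \<open>N\<close>-dimensional exponential space with real exponents has fewer than \<open>N\<close> zeros,
  counted with multiplicity, so the difference is zero.
\<close>

section \<open>Iterated derivatives\<close>

lemma nth_deriv_0 [simp]: "nth_deriv 0 f = f"
  by (simp add: nth_deriv_def)

lemma nth_deriv_Suc: "nth_deriv (Suc k) f = (\<lambda>x. vector_derivative (nth_deriv k f) (at x))"
  by (simp add: nth_deriv_def)

lemma smooth_nth_deriv:
  assumes "smooth f"
  shows "(nth_deriv k f has_vector_derivative nth_deriv (Suc k) f x) (at x)"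
  using assms by (simp add: smooth_def nth_deriv_Suc vector_derivative_works)

text \<open>A whole candidate sequence of derivatives is checked at once: one differentiation rule
  valid for every index yields smoothness and all iterated derivatives together.\<close>

lemma
  assumes "\<And>k x. (F k has_vector_derivative F (Suc k) x) (at x)"
  shows smoothI: "smooth (F 0)" and nth_deriv_eqI: "nth_deriv k (F 0) = F k"
proof -
  have eq: "nth_deriv k (F 0) = F k" for k
    by (induction k) (auto simp: nth_deriv_Suc intro!: ext vector_derivative_at assms)
  then show "nth_deriv k (F 0) = F k" .
  show "smooth (F 0)"
    unfolding smooth_def eq using assms differentiableI_vector by blast
qed

lemma
  assumes "smooth f" "smooth g"
  shows smooth_lincomb: "smooth (\<lambda>x. a * f x + b * g x)"
    and nth_deriv_lincomb:
      "nth_deriv k (\<lambda>x. a * f x + b * g x) x = a * nth_deriv k f x + b * nth_deriv k g x"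
proof -
  let ?F = "\<lambda>k x. a * nth_deriv k f x + b * nth_deriv k g x"
  have *: "(?F k has_vector_derivative ?F (Suc k) x) (at x)" for k x
    by (intro has_vector_derivative_add has_vector_derivative_mult_right smooth_nth_deriv assms)
  show "smooth (\<lambda>x. a * f x + b * g x)"
    using smoothI[of ?F, OF *] by simp
  show "nth_deriv k (\<lambda>x. a * f x + b * g x) x = a * nth_deriv k f x + b * nth_deriv k g x"
    using nth_deriv_eqI[of ?F, OF *] by simp
qed

lemma
  assumes "smooth f"
  shows smooth_times_x: "smooth (\<lambda>x. of_real x * f x)"
    and nth_deriv_times_x:
      "nth_deriv k (\<lambda>x. of_real x * f x) x = of_real x * nth_deriv k f x + of_nat k * nth_deriv (k - 1) f x"
proof -
  \<comment> \<open>Leibniz rule. At \<open>k = 0\<close> the truncated \<open>k - 1\<close> does no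
    harm, since its coefficient is zero.\<close>
  let ?F = "\<lambda>k x. of_real x * nth_deriv k f x + of_nat k * nth_deriv (k - 1) f x"
  have *: "(?F k has_vector_derivative ?F (Suc k) x) (at x)" for k x
  proof -
    have x: "((\<lambda>x. of_real x) has_vector_derivative (1::complex)) (at x)"
      using has_vector_derivative_of_real[OF DERIV_ident] by simp
    have "((\<lambda>x. of_nat k * nth_deriv (k - 1) f x) has_vector_derivative of_nat k * nth_deriv k f x) (at x)"
    proof (cases k)
      case (Suc j)
      then show ?thesis
        using has_vector_derivative_mult_right[OF smooth_nth_deriv[OF assms, of j x]] by simp
    qed simp
    from has_vector_derivative_add[OF has_vector_derivative_mult[OF x smooth_nth_deriv[OF assms]] this]
    show ?thesis
      by (simp add: algebra_simps)
  qed
  show "smooth (\<lambda>x. of_real x * f x)"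
    using smoothI[of ?F, OF *] by simp
  show "nth_deriv k (\<lambda>x. of_real x * f x) x = of_real x * nth_deriv k f x + of_nat k * nth_deriv (k - 1) f x"
    using nth_deriv_eqI[of ?F, OF *] by simp
qed

section \<open>First-order factors\<close>

definition lin_op :: "real \<Rightarrow> (real \<Rightarrow> complex) \<Rightarrow> real \<Rightarrow> complex" where
  "lin_op l f = (\<lambda>x. vector_derivative f (at x) - of_real l * f x)"

lemma diff_op_Nil [simp]: "diff_op [] f = f"
  and diff_op_Cons: "diff_op (l # L) f = lin_op l (diff_op L f)"
  and diff_op_append: "diff_op (K @ L) f = diff_op K (diff_op L f)"
  by (simp_all add: diff_op_def lin_op_def)

lemma lin_op_eq: "lin_op l f x = nth_deriv 1 f x - of_real l * f x"
  by (simp add: lin_op_def nth_deriv_Suc)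

lemma
  assumes "smooth f"
  shows smooth_lin_op: "smooth (lin_op l f)"
    and nth_deriv_lin_op: "nth_deriv k (lin_op l f) x = nth_deriv (Suc k) f x - of_real l * nth_deriv k f x"
proof -
  let ?F = "\<lambda>k x. nth_deriv (Suc k) f x - of_real l * nth_deriv k f x"
  have *: "(?F k has_vector_derivative ?F (Suc k) x) (at x)" for k x
    by (intro has_vector_derivative_diff has_vector_derivative_mult_right smooth_nth_deriv assms)
  have 0: "?F 0 = lin_op l f"
    by (simp add: lin_op_eq fun_eq_iff)
  show "smooth (lin_op l f)"
    using smoothI[of ?F, OF *] unfolding 0 .
  show "nth_deriv k (lin_op l f) x = nth_deriv (Suc k) f x - of_real l * nth_deriv k f x"
    using nth_deriv_eqI[of ?F k, OF *] unfolding 0 by simp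
qed

lemma smooth_diff_op: "smooth f \<Longrightarrow> smooth (diff_op L f)"
  by (induction L) (simp_all add: diff_op_Cons smooth_lin_op)

lemma lin_op_commute:
  assumes "smooth f"
  shows "lin_op l (lin_op m f) = lin_op m (lin_op l f)"
  by (rule ext) (simp add: lin_op_eq[of _ "lin_op _ f"] nth_deriv_lin_op[OF assms] lin_op_eq[of _ f]
      algebra_simps)

lemma lin_op_lincomb:
  assumes "smooth f" "smooth g"
  shows "lin_op l (\<lambda>x. a * f x + b * g x) = (\<lambda>x. a * lin_op l f x + b * lin_op l g x)"
  by (rule ext) (simp add: lin_op_eq nth_deriv_lincomb[OF assms] algebra_simps)

lemma diff_op_lincomb:
  assumes "smooth f" "smooth g"
  shows "diff_op L (\<lambda>x. a * f x + b * g x) = (\<lambda>x. a * diff_op L f x + b * diff_op L g x)"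
  by (induction L) (simp_all add: diff_op_Cons lin_op_lincomb smooth_diff_op assms)

lemma diff_op_lin_op:
  assumes "smooth f"
  shows "diff_op L (lin_op l f) = lin_op l (diff_op L f)"
  by (induction L) (simp_all add: diff_op_Cons lin_op_commute smooth_diff_op assms)

text \<open>First-order factors with constant coefficients commute on smooth functions, so a list
  matters only through its multiset of exponents. This allows spaces with differently ordered lists
  to be compared.\<close>

lemma diff_op_mset_cong:
  assumes "smooth f" "mset K = mset L"
  shows "diff_op K f = diff_op L f"
  using assms(2)
proof (induction K arbitrary: L)
  case (Cons l K)
  then have "l \<in> set L"
    by (metis list.set_intros(1) set_mset_mset)
  then obtain L1 L2 where L: "L = L1 @ l # L2"
    by (meson split_list)
  with Cons.prems have "mset K = mset (L1 @ L2)"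
    by simp
  from Cons.IH[OF this] show ?case
    by (simp add: L diff_op_Cons diff_op_append diff_op_lin_op smooth_diff_op assms(1))
qed simp

lemma diff_op_zero: "diff_op L (\<lambda>x. 0) = (\<lambda>x. 0)"
  by (induction L) (simp_all add: diff_op_Cons lin_op_def)

lemma exp_poly_space_iff: "f \<in> exp_poly_space L \<longleftrightarrow> smooth f \<and> diff_op L f = (\<lambda>x. 0)"
  by (auto simp: exp_poly_space_def)

lemma exp_poly_space_lincomb:
  assumes "f \<in> exp_poly_space L" "g \<in> exp_poly_space L"
  shows "(\<lambda>x. a * f x + b * g x) \<in> exp_poly_space L"
  using assms by (auto simp: exp_poly_space_iff diff_op_lincomb smooth_lincomb)

text \<open>The last list entry acts first on \<open>f\<close>, hence the reverse inductions over
  exponent lists below.\<close>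

lemma exp_poly_space_snoc:
  assumes "smooth f"
  shows "f \<in> exp_poly_space (L @ [l]) \<longleftrightarrow> lin_op l f \<in> exp_poly_space L"
  using assms by (simp add: exp_poly_space_iff diff_op_append diff_op_Cons smooth_lin_op)

text \<open>The additional factors can be moved to the outside, where they act on the zero
  function.\<close>

lemma exp_poly_space_mono:
  assumes "mset L \<subseteq># mset M"
  shows "exp_poly_space L \<subseteq> exp_poly_space M"
proof
  fix f assume f: "f \<in> exp_poly_space L"
  obtain K where "mset K = mset M - mset L"
    using ex_mset by blast
  with assms have "mset M = mset (K @ L)"
    by simp
  with f show "f \<in> exp_poly_space M"
    using diff_op_mset_cong[of f M "K @ L"]
    by (auto simp: exp_poly_space_iff diff_op_append diff_op_zero)
qed

lemma lin_op_times_x: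
  assumes "smooth f"
  shows "lin_op l (\<lambda>x. of_real x * f x) = (\<lambda>x. 1 * (of_real x * lin_op l f x) + 1 * f x)"
  by (rule ext) (simp add: lin_op_eq nth_deriv_times_x[OF assms] algebra_simps)

text \<open>
  With \<open>P\<close> the characteristic polynomial of \<open>L\<close>, \<open>P(D) (x f) = x P(D) f + P'(D) f\<close>, and \<open>P'\<close> is the sum
  of the products with one factor removed.
\<close>

lemma times_x_exp_poly_space:
  assumes "f \<in> exp_poly_space L" "\<And>l. l \<in> set L \<Longrightarrow> f \<in> exp_poly_space (remove1 l L)"
  shows "(\<lambda>x. of_real x * f x) \<in> exp_poly_space L"
  using assms
proof (induction L arbitrary: f rule: rev_induct)
  case Nil
  then show ?case
    using smooth_times_x[of f] by (auto simp: exp_poly_space_iff)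
next
  case (snoc l L)
  have sm: "smooth f"
    using snoc.prems(1) by (simp add: exp_poly_space_iff)
  \<comment> \<open>If \<open>l\<close> also occurs in \<open>L\<close>, \<open>remove1\<close>
    strikes that earlier copy; only the multisets agree.\<close>
  have "mset (remove1 l (L @ [l])) \<subseteq># mset L"
    by simp
  then have f: "f \<in> exp_poly_space L"
    using snoc.prems(2)[of l] exp_poly_space_mono by fastforce
  have "(\<lambda>x. of_real x * lin_op l f x) \<in> exp_poly_space L"
  proof (rule snoc.IH)
    show "lin_op l f \<in> exp_poly_space L"
      using snoc.prems(1) sm by (simp add: exp_poly_space_snoc)
  next
    fix m assume "m \<in> set L"
    then have "remove1 m (L @ [l]) = remove1 m L @ [l]"
      by (simp add: remove1_append)
    with \<open>m \<in> set L\<close> snoc.prems(2)[of m] have "f \<in> exp_poly_space (remove1 m L @ [l])"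
      by simp
    then show "lin_op l f \<in> exp_poly_space (remove1 m L)"
      using sm by (simp add: exp_poly_space_snoc)
  qed
  from exp_poly_space_lincomb[OF this f, of 1 1]
  show ?case
    by (simp only: exp_poly_space_snoc[OF smooth_times_x[OF sm]] lin_op_times_x[OF sm])
qed

section \<open>Zeros\<close>

text \<open>Zeros are added from left to right. Rolle between the old maximum and the new point
  gives a zero of \<open>h'\<close> beyond all those found before, hence a new one.\<close>

lemma Rolle_finite:
  fixes h h' :: "real \<Rightarrow> real"
  assumes der: "\<And>x. (h has_real_derivative h' x) (at x)"
    and "finite W" "W \<noteq> {}" "\<And>w. w \<in> W \<Longrightarrow> h w = 0"
  shows "\<exists>Z. finite Z \<and> Z \<subseteq> {Min W<..<Max W} \<and> Suc (card Z) = card W \<and> (\<forall>z\<in>Z. h' z = 0)"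
  using assms(2-)
proof (induction W rule: finite_linorder_max_induct)
  case (insert b A)
  show ?case
  proof (cases "A = {}")
    case True
    then show ?thesis
      by (intro exI[of _ "{}"]) simp
  next
    case False
    with insert obtain Z where Z: "finite Z" "Z \<subseteq> {Min A<..<Max A}" "Suc (card Z) = card A"
      "\<forall>z\<in>Z. h' z = 0"
      by auto
    have MA: "Max A \<in> A" "Min A \<in> A"
      using False insert.hyps(1) by auto
    then have lt: "Max A < b"
      using insert.hyps(2) by blast
    have "h (Max A) = h b"
      using MA insert.prems by simp
    moreover have "continuous_on {Max A..b} h"
      using der by (meson DERIV_isCont continuous_at_imp_continuous_on)
    ultimately obtain z where z: "Max A < z" "z < b" "h' z = 0"
      using Rolle_deriv[of "Max A" b h "\<lambda>x y. h' x * y"] lt der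
      by (metis has_field_derivative_def mult.right_neutral)
    have "Min (insert b A) = Min A" "Max (insert b A) = b"
      using MA lt insert.hyps(1) False Min_le[OF insert.hyps(1), of "Max A"]
      by (simp_all add: Min_insert Max_insert)
    moreover have "Min A < z"
      using z(1) Min_le[OF insert.hyps(1), of "Max A"] MA by linarith
    moreover have "z \<notin> Z" "b \<notin> A"
      using z Z(2) insert.hyps(2) by auto
    ultimately show ?thesis
      using Z z lt insert.hyps(1) by (intro exI[of _ "insert z Z"]) (auto simp: subset_iff)
  qed
qed simp

text \<open>Since \<open>l\<close> is real, taking real parts commutes with \<open>lin_op l\<close>.
  The exponential weight never vanishes, so Rolle for the product speaks about zeros of
  \<open>Re f\<close> and of \<open>Re (lin_op l f)\<close>.\<close>

lemma exp_mult_Re_deriv: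
  assumes "smooth f"
  shows "((\<lambda>x. exp (- l * x) * Re (f x)) has_real_derivative exp (- l * x) * Re (lin_op l f x)) (at x)"
proof -
  have "(f has_vector_derivative nth_deriv 1 f x) (at x)"
    using smooth_nth_deriv[OF assms, of 0 x] by simp
  then show ?thesis
    by (auto intro!: derivative_eq_intros simp: lin_op_eq algebra_simps)
qed

text \<open>
  Rolle's theorem needs real functions, and interior zeros have to be tracked for the induction:
  each step may lose one zero at each end but gains one inside.
\<close>

lemma Re_eq_0_if_many_zeros:
  assumes "smooth f" "\<And>x. Re (diff_op L f x) = 0"
    and "finite Z" "Z \<subseteq> {0<..<1}" "\<And>z. z \<in> Z \<Longrightarrow> Re (f z) = 0"
    and "\<And>j. j < a \<Longrightarrow> Re (nth_deriv j f 0) = 0" "\<And>j. j < b \<Longrightarrow> Re (nth_deriv j f 1) = 0"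
    and "length L \<le> a + b + card Z"
  shows "Re (f x) = 0"
  using assms
proof (induction L arbitrary: f Z a b x rule: rev_induct)
  case (snoc l L)
  note sm = snoc.prems(1)
  define h where "h = (\<lambda>x. exp (- l * x) * Re (f x))"
  note der = exp_mult_Re_deriv[OF sm, of l, folded h_def]
  \<comment> \<open>For Rolle an end point counts once; its remaining multiplicity
    \<open>a - 1\<close> or \<open>b - 1\<close> passes to \<open>lin_op l f\<close>. With
    \<open>a = 0\<close> or \<open>b = 0\<close> the point is absent and the truncated difference is
    0, so the total count is kept.\<close>
  define W where "W = Z \<union> (if a > 0 then {0} else {}) \<union> (if b > 0 then {1} else {})"
  have W: "finite W" "W \<subseteq> {0..1}"
    using snoc.prems(3,4) by (auto simp: W_def)
  have "0 \<notin> Z" "1 \<notin> Z"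
    using snoc.prems(4) by auto
  then have "card W = card Z + (if a > 0 then 1 else 0) + (if b > 0 then 1 else 0)"
    using snoc.prems(3) by (auto simp: W_def)
  moreover have "1 \<le> a + b + card Z"
    using snoc.prems(8) by simp
  ultimately have cW: "length L + 1 \<le> (a - 1) + (b - 1) + card W" "card W > 0"
    using snoc.prems(8) by (auto split: if_splits)
  then have "W \<noteq> {}"
    by auto
  have f0: "Re (f w) = 0" if "w \<in> W" for w
    using that snoc.prems(5,6,7)[of 0] snoc.prems(5) by (auto simp: W_def split: if_splits)
  obtain Z' where Z': "finite Z'" "Z' \<subseteq> {Min W<..<Max W}" "Suc (card Z') = card W"
    "\<forall>z\<in>Z'. exp (- l * z) * Re (lin_op l f z) = 0"
    using Rolle_finite[of h, OF der W(1) \<open>W \<noteq> {}\<close>] f0 by (auto simp: h_def)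
  have "Min W \<in> W" "Max W \<in> W"
    using W(1) \<open>W \<noteq> {}\<close> by auto
  then have "{Min W<..<Max W} \<subseteq> {0<..<1}"
    using W(2) by fastforce
  have g0: "Re (lin_op l f x) = 0" for x
  proof (rule snoc.IH[of _ Z' "a - 1" "b - 1"])
    show "smooth (lin_op l f)"
      by (rule smooth_lin_op[OF sm])
    show "Re (diff_op L (lin_op l f) x) = 0" for x
      using snoc.prems(2)[of x] by (simp add: diff_op_append diff_op_Cons)
    show "finite Z'" "Z' \<subseteq> {0<..<1}"
      using Z' \<open>{Min W<..<Max W} \<subseteq> {0<..<1}\<close> by auto
    show "Re (lin_op l f z) = 0" if "z \<in> Z'" for z
      using that Z'(4) by simp
    show "Re (nth_deriv j (lin_op l f) 0) = 0" if "j < a - 1" for j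
      using that snoc.prems(6)[of j] snoc.prems(6)[of "Suc j"] by (simp add: nth_deriv_lin_op[OF sm])
    show "Re (nth_deriv j (lin_op l f) 1) = 0" if "j < b - 1" for j
      using that snoc.prems(7)[of j] snoc.prems(7)[of "Suc j"] by (simp add: nth_deriv_lin_op[OF sm])
    show "length L \<le> a - 1 + (b - 1) + card Z'"
      using cW Z'(3) by linarith
  qed
  \<comment> \<open>Now \<open>h\<close> is constant, and it has a zero because \<open>W\<close> is
    nonempty.\<close>
  have "(h has_real_derivative 0) (at x)" for x
    using der[of x] g0[of x] by simp
  then have "h x = h (Min W)"
    using DERIV_isconst_all by blast
  also have "\<dots> = 0"
    using f0[OF \<open>Min W \<in> W\<close>] by (simp add: h_def)
  finally show ?case
    by (simp add: h_def)
qed simp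

lemma exp_poly_space_eq_0:
  assumes "f \<in> exp_poly_space L"
    and "\<And>j. j < a \<Longrightarrow> nth_deriv j f 0 = 0" "\<And>j. j < b \<Longrightarrow> nth_deriv j f 1 = 0"
    and "length L \<le> a + b"
  shows "f x = 0"
proof -
  have sm: "smooth f" and f: "diff_op L f = (\<lambda>x. 0)"
    using assms(1) by (auto simp: exp_poly_space_iff)
  have "Re (f x) = 0"
    using Re_eq_0_if_many_zeros[of f L "{}" a b x] sm f assms by simp
  \<comment> \<open>This real part is the imaginary part of \<open>f x\<close>; the zero summand
    gives the shape of the linear combination lemmas.\<close>
  moreover have "Re (- \<i> * f x + 0 * f x) = 0"
    by (rule Re_eq_0_if_many_zeros[of "\<lambda>x. - \<i> * f x + 0 * f x" L "{}" a b x])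
      (use sm f assms in \<open>simp_all only: smooth_lincomb diff_op_lincomb nth_deriv_lincomb, simp_all\<close>)
  ultimately show ?thesis
    by (simp add: complex_eq_iff)
qed

section \<open>Existence and uniqueness of the Bernstein functions\<close>

text \<open>Variation of constants: integrate \<open>g\<close> against \<open>exp (- l * x)\<close>
  and multiply back by \<open>exp (l * x)\<close>.\<close>

lemma lin_op_surj:
  assumes "smooth g"
  shows "\<exists>f. smooth f \<and> f 0 = c \<and> lin_op l f = g"
proof -
  have "continuous (at x) g" for x
    using smooth_nth_deriv[OF assms, of 0 x] has_vector_derivative_continuous by auto
  then have "\<exists>G. \<forall>x::real. -\<infinity> < ereal x \<longrightarrow> ereal x < \<infinity> \<longrightarrow>
      (G has_vector_derivative of_real (exp (- l * x)) * g x) (at x)"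
    by (intro einterval_antiderivative) (auto intro!: continuous_intros)
  then obtain G where G: "\<And>x. (G has_vector_derivative of_real (exp (- l * x)) * g x) (at x)"
    by auto
  define f where "f = (\<lambda>x. of_real (exp (l * x)) * (G x - G 0 + c))"
  have e: "((\<lambda>x. of_real (exp (l * x))) has_vector_derivative (of_real (l * exp (l * x)) :: complex)) (at x)" for x
    by (rule has_vector_derivative_of_real) (auto intro!: derivative_eq_intros)
  have "(f has_vector_derivative of_real (exp (l * x)) * (of_real (exp (- l * x)) * g x - 0 + 0)
      + of_real (l * exp (l * x)) * (G x - G 0 + c)) (at x)" for x
    unfolding f_def
    by (intro has_vector_derivative_mult e has_vector_derivative_add has_vector_derivative_diff G
        has_vector_derivative_const)
  moreover have "of_real (exp (l * x)) * (of_real (exp (- l * x)) * g x - 0 + 0)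
      + of_real (l * exp (l * x)) * (G x - G 0 + c) = of_real l * f x + g x" for x
    by (simp add: f_def exp_minus field_simps flip: exp_of_real)
  ultimately have f: "(f has_vector_derivative of_real l * f x + g x) (at x)" for x
    by simp
  \<comment> \<open>The equation f' = l f + g, differentiated repeatedly, expresses every derivative
    of \<open>f\<close> through lower ones and those of \<open>g\<close>.\<close>
  define F where "F = rec_nat f (\<lambda>k h x. of_real l * h x + nth_deriv k g x)"
  have F: "F 0 = f" "F (Suc k) = (\<lambda>x. of_real l * F k x + nth_deriv k g x)" for k
    by (simp_all add: F_def)
  have "(F k has_vector_derivative F (Suc k) x) (at x)" for k x
  proof (induction k arbitrary: x)
    case 0
    then show ?case
      using f by (simp add: F)
  next
    case (Suc k)
    have "((\<lambda>x. of_real l * F k x + nth_deriv k g x) has_vector_derivative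
        of_real l * F (Suc k) x + nth_deriv (Suc k) g x) (at x)"
      by (intro has_vector_derivative_add has_vector_derivative_mult_right Suc smooth_nth_deriv assms)
    then show ?case
      by (simp only: F(2))
  qed
  from smoothI[of F, OF this] have "smooth f"
    by (simp add: F)
  moreover have "f 0 = c"
    by (simp add: f_def)
  moreover have "lin_op l f = g"
    by (auto simp: lin_op_def vector_derivative_at[OF f])
  ultimately show ?thesis
    by blast
qed

text \<open>For \<open>a = 0\<close> the solution is an exponential. Otherwise inverting the
  innermost factor with initial value 0 raises the order of the zero at 0 by one.\<close>

lemma exp_poly_space_initial:
  assumes "a < length L"
  shows "\<exists>f\<in>exp_poly_space L. (\<forall>j<a. nth_deriv j f 0 = 0) \<and> nth_deriv a f 0 = 1"
  using assms
proof (induction L arbitrary: a rule: rev_induct)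
  case (snoc l L)
  show ?case
  proof (cases a)
    case 0
    have "smooth (\<lambda>x. 0)"
      using smoothI[of "\<lambda>k x. 0"] by simp
    then obtain f where f: "smooth f" "f 0 = 1" "lin_op l f = (\<lambda>x. 0)"
      using lin_op_surj by blast
    then have "f \<in> exp_poly_space (L @ [l])"
      by (simp add: exp_poly_space_iff diff_op_append diff_op_Cons diff_op_zero)
    with f 0 show ?thesis
      by auto
  next
    case (Suc b)
    with snoc obtain g where g: "g \<in> exp_poly_space L" "\<forall>j<b. nth_deriv j g 0 = 0" "nth_deriv b g 0 = 1"
      by force
    then obtain f where f: "smooth f" "f 0 = 0" "lin_op l f = g"
      using lin_op_surj by (metis exp_poly_space_iff)
    have step: "nth_deriv (Suc j) f 0 = nth_deriv j g 0 + of_real l * nth_deriv j f 0" for j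
      using nth_deriv_lin_op[OF f(1), of j l 0] f(3) by simp
    have f0: "nth_deriv j f 0 = 0" if "j < a" for j
      using that
    proof (induction j)
      case (Suc j)
      with step[of j] g(2) \<open>a = Suc b\<close> show ?case
        by simp
    qed (simp add: f)
    moreover have "nth_deriv a f 0 = 1"
      using step[of b] f0[of b] g(3) Suc by simp
    moreover have "f \<in> exp_poly_space (L @ [l])"
      using f g by (simp add: exp_poly_space_snoc)
    ultimately show ?thesis
      by blast
  qed
qed simp

text \<open>An additional zero at 1 is obtained by adding a multiple of an element whose order at 0
  is so high that the data at 0 stay intact.\<close>

lemma exp_poly_space_two_point:
  assumes "a + b < length L"
  shows "\<exists>f\<in>exp_poly_space L. (\<forall>j<a. nth_deriv j f 0 = 0) \<and> nth_deriv a f 0 = 1 \<and>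
    (\<forall>j<b. nth_deriv j f 1 = 0)"
  using assms
proof (induction b arbitrary: a)
  case 0
  then show ?case
    using exp_poly_space_initial[of a L] by simp
next
  case (Suc b)
  \<comment> \<open>The largest order at 0 compatible with order \<open>b\<close> at 1: one more
    zero at 1 would give \<open>g\<close> as many zeros as the dimension, forcing it to
    vanish.\<close>
  define c where "c = length L - 1 - b"
  have c: "a < c" "c + b < length L" "length L \<le> c + Suc b"
    using Suc.prems by (auto simp: c_def)
  obtain f where f: "f \<in> exp_poly_space L" "\<forall>j<a. nth_deriv j f 0 = 0" "nth_deriv a f 0 = 1"
    "\<forall>j<b. nth_deriv j f 1 = 0"
    using Suc.IH[of a] Suc.prems by auto
  obtain g where g: "g \<in> exp_poly_space L" "\<forall>j<c. nth_deriv j g 0 = 0" "nth_deriv c g 0 = 1"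
    "\<forall>j<b. nth_deriv j g 1 = 0"
    using Suc.IH[of c] c by auto
  have "nth_deriv b g 1 \<noteq> 0"
  proof
    assume "nth_deriv b g 1 = 0"
    then have "g = (\<lambda>x. 0)"
      using exp_poly_space_eq_0[OF g(1), of c "Suc b"] g c by (auto simp: less_Suc_eq)
    moreover have "nth_deriv c (\<lambda>x. 0) = (\<lambda>x. 0)"
      using nth_deriv_eqI[of "\<lambda>k x. 0"] by simp
    ultimately show False
      using g(3) by simp
  qed
  define t where "t = - nth_deriv b f 1 / nth_deriv b g 1"
  let ?h = "\<lambda>x. 1 * f x + t * g x"
  have "smooth f" "smooth g"
    using f(1) g(1) by (auto simp: exp_poly_space_iff)
  note nd = nth_deriv_lincomb[OF this, of _ 1 t]
  have "?h \<in> exp_poly_space L"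
    by (rule exp_poly_space_lincomb[OF f(1) g(1)])
  moreover have "\<forall>j<a. nth_deriv j ?h 0 = 0" "nth_deriv a ?h 0 = 1"
    unfolding nd using f g c by auto
  moreover have "\<forall>j<Suc b. nth_deriv j ?h 1 = 0"
    unfolding nd using f(4) g(4) \<open>nth_deriv b g 1 \<noteq> 0\<close> by (auto simp: t_def less_Suc_eq)
  ultimately show ?case
    by blast
qed

text \<open>Justifies the definite description. The zero at 1 has exact order because one more would
  force the function to vanish.\<close>

lemma bernstein_props:
  assumes "k < length L"
  shows "bernstein L k \<in> exp_poly_space L \<and> zero_of_exact_order (bernstein L k) k 0 \<and>
    zero_of_exact_order (bernstein L k) (length L - 1 - k) 1 \<and> nth_deriv k (bernstein L k) 0 = 1"
proof -
  let ?m = "length L - 1 - k"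
  let ?P = "\<lambda>p. p \<in> exp_poly_space L \<and> zero_of_exact_order p k 0 \<and>
    zero_of_exact_order p ?m 1 \<and> nth_deriv k p 0 = 1"
  have m: "k + ?m < length L" "length L \<le> k + Suc ?m"
    using assms by simp_all
  obtain f where f: "f \<in> exp_poly_space L" "\<forall>j<k. nth_deriv j f 0 = 0" "nth_deriv k f 0 = 1"
    "\<forall>j<?m. nth_deriv j f 1 = 0"
    using exp_poly_space_two_point[OF m(1)] by blast
  have "nth_deriv ?m f 1 \<noteq> 0"
  proof
    assume "nth_deriv ?m f 1 = 0"
    then have "f = (\<lambda>x. 0)"
      using exp_poly_space_eq_0[OF f(1) _ _ m(2)] f by (auto simp: less_Suc_eq)
    moreover have "nth_deriv k (\<lambda>x. 0) = (\<lambda>x. 0)"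
      using nth_deriv_eqI[of "\<lambda>k x. 0"] by simp
    ultimately show False
      using f(3) by simp
  qed
  then have "?P f"
    using f by (simp add: zero_of_exact_order_def)
  moreover have "p = q" if p: "?P p" and q: "?P q" for p q
  proof
    fix x
    have sm: "smooth p" "smooth q"
      using p q by (auto simp: exp_poly_space_iff)
    \<comment> \<open>The common normalization adds a zero at 0, so the difference vanishes to order
      \<open>Suc k\<close> there.\<close>
    have "1 * p x + (- 1) * q x = 0"
    proof (rule exp_poly_space_eq_0[of _ L "Suc k" ?m])
      show "(\<lambda>x. 1 * p x + (- 1) * q x) \<in> exp_poly_space L"
        using p q by (intro exp_poly_space_lincomb) auto
    qed (use p q assms in \<open>simp_all only: nth_deriv_lincomb[OF sm],
        auto simp: zero_of_exact_order_def less_Suc_eq\<close>)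
    then show "p x = q x"
      by simp
  qed
  ultimately have "\<exists>!p. ?P p"
    by blast
  from theI'[OF this] show ?thesis
    unfolding bernstein_def .
qed

section \<open>The recursion\<close>

theorem theorem27:
  fixes lam mu :: real and s k :: nat and \<Lambda> :: "real list" and A :: complex and x :: real
  assumes "s \<ge> 1"
    and "k \<le> 2 * s - 1"
    and "\<Lambda> = Lambda_plus s lam mu \<or> \<Lambda> = Lambda_minus s lam mu"
    and "A = of_nat (k + 2) * nth_deriv (k + 1) (bernstein (Lambda_odd s lam mu) k) 0
           - of_nat (k + 1) * nth_deriv (k + 2) (bernstein \<Lambda> (k + 1)) 0"
  shows "A * bernstein (Lambda_odd (s + 1) lam mu) (k + 2) x
       = of_real x * bernstein (Lambda_odd s lam mu) k x
         - of_nat (k + 1) * bernstein \<Lambda> (k + 1) x"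
proof -
  let ?L = "Lambda_odd (s + 1) lam mu"
  note defs = Lambda_odd_def Lambda_plus_def Lambda_minus_def two_exponents_def
  define q where "q = bernstein (Lambda_odd s lam mu) k"
  define r where "r = bernstein \<Lambda> (k + 1)"
  define p where "p = bernstein ?L (k + 2)"
  \<comment> \<open>The common order of all three functions at 1, as (2s - 1) - k = 2s - (k + 1) =
    (2s + 1) - (k + 2).\<close>
  define m where "m = 2 * s - 1 - k"
  have len: "length (Lambda_odd s lam mu) = 2 * s" "length \<Lambda> = 2 * s + 1" "length ?L = 2 * s + 2"
    using assms(3) by (auto simp: defs)
  have q: "q \<in> exp_poly_space (Lambda_odd s lam mu)" "\<forall>j<k. nth_deriv j q 0 = 0"
    "nth_deriv k q 0 = 1" "\<forall>j<m. nth_deriv j q 1 = 0"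
    using bernstein_props[of k "Lambda_odd s lam mu"] assms(1,2) len
    by (auto simp: q_def m_def zero_of_exact_order_def)
  have r: "r \<in> exp_poly_space \<Lambda>" "\<forall>j<k + 1. nth_deriv j r 0 = 0"
    "nth_deriv (k + 1) r 0 = 1" "\<forall>j<m. nth_deriv j r 1 = 0"
    using bernstein_props[of "k + 1" \<Lambda>] assms(1,2) len
    by (auto simp: r_def m_def zero_of_exact_order_def)
  have p: "p \<in> exp_poly_space ?L" "\<forall>j<k + 2. nth_deriv j p 0 = 0"
    "nth_deriv (k + 2) p 0 = 1" "\<forall>j<m. nth_deriv j p 1 = 0"
    using bernstein_props[of "k + 2" ?L] assms(1,2) len
    by (auto simp: p_def m_def zero_of_exact_order_def)
  have sm: "smooth q" "smooth r" "smooth p"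
    using q r p by (auto simp: exp_poly_space_iff)
  have xq: "(\<lambda>x. of_real x * q x) \<in> exp_poly_space ?L"
  proof (rule times_x_exp_poly_space)
    show "q \<in> exp_poly_space ?L"
      by (rule subsetD[OF exp_poly_space_mono q(1)]) (simp add: defs subseteq_mset_def)
    \<comment> \<open>Each of the two blocks in \<open>?L\<close> has s + 1 entries, so after one
      removal the s copies of each that annihilate \<open>q\<close> are still there, also when
      \<open>lam = mu\<close>.\<close>
    show "q \<in> exp_poly_space (remove1 l ?L)" if "l \<in> set ?L" for l
    proof (rule subsetD[OF exp_poly_space_mono q(1)])
      have "l = lam \<or> l = mu"
        using that by (auto simp: defs)
      then show "mset (Lambda_odd s lam mu) \<subseteq># mset (remove1 l ?L)"
        by (auto simp: defs subseteq_mset_def)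
    qed
  qed
  have r': "r \<in> exp_poly_space ?L"
    by (rule subsetD[OF exp_poly_space_mono r(1)]) (use assms(3) in \<open>auto simp: defs subseteq_mset_def\<close>)
  let ?F = "\<lambda>x. 1 * (of_real x * q x) + (- of_nat (k + 1)) * r x"
  let ?G = "\<lambda>x. 1 * ?F x + (- A) * p x"
  have smF: "smooth ?F"
    by (intro smooth_lincomb smooth_times_x sm)
  have nd: "nth_deriv j ?G x = of_real x * nth_deriv j q x + of_nat j * nth_deriv (j - 1) q x
      - of_nat (k + 1) * nth_deriv j r x - A * nth_deriv j p x" for j x
    unfolding nth_deriv_lincomb[OF smF sm(3)] nth_deriv_lincomb[OF smooth_times_x[OF sm(1)] sm(2)]
      nth_deriv_times_x[OF sm(1)] by (simp add: algebra_simps)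
  have "?G x = 0"
  proof (rule exp_poly_space_eq_0[of _ ?L "k + 3" m])
    show "?G \<in> exp_poly_space ?L"
      by (intro exp_poly_space_lincomb xq r' p(1))
    show "nth_deriv j ?G 0 = 0" if "j < k + 3" for j
    proof -
      \<comment> \<open>Below k + 1 every term vanishes. At k + 1 the contributions of x q and (k +
        1) r are both k + 1 and cancel. At k + 2 the choice of \<open>A\<close> gives zero.\<close>
      consider "j < k + 1" | "j = k + 1" | "j = k + 2"
        using \<open>j < k + 3\<close> by linarith
      then show ?thesis
      proof cases
        case 1
        then have "of_nat j * nth_deriv (j - 1) q 0 = 0"
          using q(2) by (cases j) auto
        with 1 show ?thesis
          unfolding nd using r(2) p(2) by simp
      next
        case 2
        then show ?thesis
          unfolding nd using q(3) r(3) p(2) by simp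
      next
        case 3
        then show ?thesis
          unfolding nd using p(3) assms(4)[folded q_def r_def] by simp
      qed
    qed
    show "nth_deriv j ?G 1 = 0" if "j < m" for j
      unfolding nd using that q(4) r(4) p(4) by simp
    \<comment> \<open>The count is exact: both sides equal 2s + 2.\<close>
    show "length ?L \<le> k + 3 + m"
      using len assms(1,2) by (simp add: m_def)
  qed
  then show ?thesis
    by (simp add: p_def q_def r_def algebra_simps)
qed

end
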